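(* Let $\Omega_0=\{(u,v): -1<u<1,\ -1<v<1\}$ and let $\Sigma_0$ be the fundamental Scherk surface, i.e. the minimal surface given on $\Omega_0$ by $$\sigma(u,v)=\left(\tan^{-1}\!\left(\frac{2u}{u^2+v^2-1}\right),\ \tan^{-1}\!\left(\frac{-2v}{u^2+v^2-1}\right),\ \log\sqrt{\frac{(u^2-v^2+1)^2+4u^2v^2}{(u^2-v^2-1)^2+4u^2v^2}}\right).$$ The functions $$\varphi^1=(uv)^2+2,\qquad \varphi^2=u-\tfrac14u^5,\qquad \varphi^3=v-\tfrac14 v^5,$$ which are pairwise orthogonal in $L^2(\Omega_0)$, belong to $\mathcal F(\Omega_0)$, and each of them destabilizes $\Sigma_0$, i.e. $Q(\varphi^i)<0$ for $i=1,2,3$. Moreover, $\mathrm{ind}_b(\Sigma_0)\ge 3$.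
   Context: For a minimal surface $\Sigma$ given by a single patch $\sigma:\Omega\to\mathbb R^3$, $\Omega\subset\mathbb R^2$ a bounded domain with coordinates $(u,v)$, let $g=(g_{ij})$ be the induced metric (first fundamental form of $\sigma$), $(g^{ij})$ its inverse, $|g|=\det(g_{ij})$, and $\kappa$ the Gaussian curvature. $\mathcal F(\Omega)$ denotes the set of smooth functions $\varphi\in\mathcal H^1(\Omega)$ all of whose partial derivatives (in $u,v$) of order at most $2$ are bounded on $\Omega$; elements of $\mathcal F(\Omega)$ are called admissible perturbations. The second variation of area in the direction of the normal variation $\sigma+t\varphi\mathbf N$ ($\mathbf N$ the unit normal) is $$Q(\varphi)=\int_\Omega\left(g^{ij}\varphi_i\varphi_j+2\kappa\varphi^2\right)\sqrt{|g|}\,du\,dv ,$$ where subscripts on $\varphi$ denote partial derivatives and repeated indices are summed. An admissible $\varphi$ destabilizes $\Sigma$ if $Q(\varphi)<0$. $\mathrm{ind}_b(\Sigma)$ is the maximal dimension of a linear subspace of $\mathcal F(\Omega)$ on which $Q$ is negative definite. For the Scherk surface, the formula for $\sigma$ is undefined on the circle $u^2+v^2=1$ (a null set), but $g$ and $\kappa$ extend smoothly across that circle inside $\Omega_0$. *)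

theory Defs
  imports
    "HOL-Analysis.Analysis"
    "HOL-Library.Function_Algebras"
    "HOL-Library.Extended_Nat"
begin

section \<open>Smooth functions on plane domains\<close>

text \<open>The coordinates \<open>(u, v)\<close> are indexed by the two-element type \<open>2\<close>: index \<open>1\<close> is \<open>u\<close>,
  index \<open>2\<close> is \<open>v\<close>.\<close>

definition coord_dir :: "2 \<Rightarrow> real \<times> real" where
  "coord_dir i = (if i = 1 then (1, 0) else (0, 1))"

definition pderiv_at :: "2 \<Rightarrow> (real \<times> real \<Rightarrow> 'a::real_normed_vector) \<Rightarrow> real \<times> real \<Rightarrow> 'a" where
  "pderiv_at i f x = vector_derivative (\<lambda>t. f (x + t *\<^sub>R coord_dir i)) (at 0)"

primrec Ck_on :: "nat \<Rightarrow> (real \<times> real) set \<Rightarrow> (real \<times> real \<Rightarrow> real) \<Rightarrow> bool" where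
  "Ck_on 0 \<Omega> f \<longleftrightarrow> continuous_on \<Omega> f"
| "Ck_on (Suc k) \<Omega> f \<longleftrightarrow> f differentiable_on \<Omega> \<and> (\<forall>i. Ck_on k \<Omega> (pderiv_at i f))"

definition smooth_on :: "(real \<times> real) set \<Rightarrow> (real \<times> real \<Rightarrow> real) \<Rightarrow> bool" where
  "smooth_on \<Omega> f \<longleftrightarrow> (\<forall>k. Ck_on k \<Omega> f)"


section \<open>The spaces \<open>L\<^sup>2\<close>, \<open>H\<^sup>1\<close> and \<open>F\<close>\<close>

text \<open>Functions on \<open>\<Omega>\<close> are represented by total functions; only their values on \<open>\<Omega>\<close> matter
  in the definitions below.\<close>

definition L2_on :: "(real \<times> real) set \<Rightarrow> (real \<times> real \<Rightarrow> real) set" where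
  "L2_on \<Omega> = {f. set_borel_measurable lborel \<Omega> f \<and> set_integrable lborel \<Omega> (\<lambda>x. (f x)\<^sup>2)}"

definition L2_inner :: "(real \<times> real) set \<Rightarrow> (real \<times> real \<Rightarrow> real) \<Rightarrow> (real \<times> real \<Rightarrow> real) \<Rightarrow> real" where
  "L2_inner \<Omega> f h = (LINT x:\<Omega>|lborel. f x * h x)"

definition L2_orthogonal :: "(real \<times> real) set \<Rightarrow> (real \<times> real \<Rightarrow> real) \<Rightarrow> (real \<times> real \<Rightarrow> real) \<Rightarrow> bool" where
  "L2_orthogonal \<Omega> f h \<longleftrightarrow> f \<in> L2_on \<Omega> \<and> h \<in> L2_on \<Omega> \<and> L2_inner \<Omega> f h = 0"

definition test_functions :: "(real \<times> real) set \<Rightarrow> (real \<times> real \<Rightarrow> real) set" where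
  "test_functions \<Omega> = {\<psi>. smooth_on UNIV \<psi> \<and>
     compact (closure {x. \<psi> x \<noteq> 0}) \<and> closure {x. \<psi> x \<noteq> 0} \<subseteq> \<Omega>}"

definition weak_pderiv :: "(real \<times> real) set \<Rightarrow> 2 \<Rightarrow> (real \<times> real \<Rightarrow> real) \<Rightarrow> (real \<times> real \<Rightarrow> real) \<Rightarrow> bool" where
  "weak_pderiv \<Omega> i f w \<longleftrightarrow> (\<forall>\<psi>\<in>test_functions \<Omega>.
     (LINT x:\<Omega>|lborel. f x * pderiv_at i \<psi> x) = - (LINT x:\<Omega>|lborel. w x * \<psi> x))"

definition H1 :: "(real \<times> real) set \<Rightarrow> (real \<times> real \<Rightarrow> real) set" where
  "H1 \<Omega> = {f \<in> L2_on \<Omega>. \<forall>i. \<exists>w\<in>L2_on \<Omega>. weak_pderiv \<Omega> i f w}"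

definition admissible :: "(real \<times> real) set \<Rightarrow> (real \<times> real \<Rightarrow> real) set" where
  "admissible \<Omega> = {\<phi>. smooth_on \<Omega> \<phi> \<and> \<phi> \<in> H1 \<Omega> \<and> bounded (\<phi> ` \<Omega>) \<and>
     (\<forall>i. bounded (pderiv_at i \<phi> ` \<Omega>)) \<and>
     (\<forall>i j. bounded (pderiv_at i (pderiv_at j \<phi>) ` \<Omega>))}"


section \<open>Geometry of a patch\<close>

type_synonym patch = "real \<times> real \<Rightarrow> real^3"

definition first_form :: "patch \<Rightarrow> real \<times> real \<Rightarrow> real^2^2" where
  "first_form \<sigma> x = (\<chi> i j. pderiv_at i \<sigma> x \<bullet> pderiv_at j \<sigma> x)"

definition unit_normal :: "patch \<Rightarrow> real \<times> real \<Rightarrow> real^3" where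
  "unit_normal \<sigma> x = (let n = cross3 (pderiv_at 1 \<sigma> x) (pderiv_at 2 \<sigma> x) in n /\<^sub>R norm n)"

definition second_form :: "patch \<Rightarrow> real \<times> real \<Rightarrow> real^2^2" where
  "second_form \<sigma> x = (\<chi> i j. pderiv_at i (pderiv_at j \<sigma>) x \<bullet> unit_normal \<sigma> x)"

definition gauss_curvature :: "patch \<Rightarrow> real \<times> real \<Rightarrow> real" where
  "gauss_curvature \<sigma> x = det (second_form \<sigma> x) / det (first_form \<sigma> x)"

text \<open>If the formula for \<open>\<sigma>\<close> breaks down on a closed null subset of \<open>\<Omega>\<close> (as it does for the Scherk
  surface below), then the integrand has arbitrary values there, which do not affect the integral;
  off that subset it only involves \<open>\<sigma>\<close> near the point in question.\<close>

definition second_variation :: "patch \<Rightarrow> (real \<times> real) set \<Rightarrow> (real \<times> real \<Rightarrow> real) \<Rightarrow> real" where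
  "second_variation \<sigma> \<Omega> \<phi> = (LINT x:\<Omega>|lborel.
     ((\<Sum>i\<in>UNIV. \<Sum>j\<in>UNIV. matrix_inv (first_form \<sigma> x) $ i $ j * pderiv_at i \<phi> x * pderiv_at j \<phi> x)
       + 2 * gauss_curvature \<sigma> x * (\<phi> x)\<^sup>2) * sqrt (det (first_form \<sigma> x)))"

definition destabilizes :: "patch \<Rightarrow> (real \<times> real) set \<Rightarrow> (real \<times> real \<Rightarrow> real) \<Rightarrow> bool" where
  "destabilizes \<sigma> \<Omega> \<phi> \<longleftrightarrow> \<phi> \<in> admissible \<Omega> \<and> second_variation \<sigma> \<Omega> \<phi> < 0"


section \<open>The index\<close>

interpretation fun_space: vector_space "\<lambda>(c::real) (f :: real \<times> real \<Rightarrow> real) x. c * f x"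
  by unfold_locales (auto simp: fun_eq_iff algebra_simps)

definition negative_definite_on :: "((real \<times> real \<Rightarrow> real) \<Rightarrow> real) \<Rightarrow> (real \<times> real \<Rightarrow> real) set \<Rightarrow> bool" where
  "negative_definite_on Q V \<longleftrightarrow> (\<forall>\<phi>\<in>V. \<phi> \<noteq> 0 \<longrightarrow> Q \<phi> < 0)"

text \<open>A subspace on which the second variation is negative definite contains no nonzero function
  vanishing on all of \<open>\<Omega>\<close>, so restriction to \<open>\<Omega>\<close> is injective on it: working with total functions
  does not change the dimensions that occur.  An infinite-dimensional subspace has \<open>dim = 0\<close>, but it
  contains subspaces of every finite dimension, which then make the supremum \<open>\<infinity>\<close>.\<close>

definition ind_b :: "patch \<Rightarrow> (real \<times> real) set \<Rightarrow> enat" where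
  "ind_b \<sigma> \<Omega> = (SUP V \<in> {V. fun_space.subspace V \<and> V \<subseteq> admissible \<Omega> \<and>
     negative_definite_on (second_variation \<sigma> \<Omega>) V}. enat (fun_space.dim V))"


section \<open>The fundamental Scherk surface\<close>

definition Omega0 :: "(real \<times> real) set" where
  "Omega0 = {(u, v). -1 < u \<and> u < 1 \<and> -1 < v \<and> v < 1}"

definition scherk :: patch where
  "scherk = (\<lambda>(u, v). vector
     [arctan (2 * u / (u\<^sup>2 + v\<^sup>2 - 1)),
      arctan (- 2 * v / (u\<^sup>2 + v\<^sup>2 - 1)),
      ln (sqrt (((u\<^sup>2 - v\<^sup>2 + 1)\<^sup>2 + 4 * u\<^sup>2 * v\<^sup>2) / ((u\<^sup>2 - v\<^sup>2 - 1)\<^sup>2 + 4 * u\<^sup>2 * v\<^sup>2)))])"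

definition phi1 :: "real \<times> real \<Rightarrow> real" where
  "phi1 = (\<lambda>(u, v). (u * v)\<^sup>2 + 2)"

definition phi2 :: "real \<times> real \<Rightarrow> real" where
  "phi2 = (\<lambda>(u, v). u - 1 / 4 * u ^ 5)"

definition phi3 :: "real \<times> real \<Rightarrow> real" where
  "phi3 = (\<lambda>(u, v). v - 1 / 4 * v ^ 5)"

end

theory Submission
  imports Defs
begin

text \<open>
  With \<open>z = u + i v\<close> one has \<open>\<sigma>\<^sub>u - i \<sigma>\<^sub>v = h \<psi>\<close> for the Weierstrass data \<open>h = 2 / (z\<^sup>4 - 1)\<close> and
  \<open>\<psi> = (1 - z\<^sup>2, i (1 + z\<^sup>2), - 2 z)\<close>.  Hence the metric is \<open>|h|\<^sup>2 (1 + |z|\<^sup>2)\<^sup>2\<close> times the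
  identity, the second form has determinant \<open>- 4 |h|\<^sup>2\<close>, and the factors \<open>|h|\<close> cancel:
  \<open>Q(\<phi>)\<close> is the integral of \<open>|\<nabla>\<phi>|\<^sup>2 - 8 \<phi>\<^sup>2 / (1 + |z|\<^sup>2)\<^sup>2\<close>.  The reflections in \<open>u\<close> and
  \<open>v\<close> make the three functions orthogonal both in \<open>L\<^sup>2\<close> and for this form, so \<open>Q\<close> is negative definite
  on their span as soon as it is negative on each of them; a polynomial lower bound for
  \<open>1 / (1 + |z|\<^sup>2)\<^sup>2\<close> reduces the latter to integrals of polynomials.
\<close>

section \<open>Integration and polynomials on the square\<close>

lemma Omega0_eq_box: "Omega0 = box (-1, -1) (1, 1)"
  by (auto simp: Omega0_def box_def Basis_prod_def)

lemma Omega0_subset_cbox: "Omega0 \<subseteq> cbox (-1, -1) (1, 1)"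
  unfolding Omega0_eq_box by (rule box_subset_cbox)

lemma Omega0_sets [measurable, simp]: "Omega0 \<in> sets borel"
  by (simp add: Omega0_eq_box)

lemma set_integrable_Omega0:
  fixes f :: "real \<times> real \<Rightarrow> real"
  assumes "continuous_on UNIV f"
  shows "set_integrable lborel Omega0 f"
proof (rule set_integrable_subset)
  show "set_integrable lborel (cbox (-1, -1) (1, 1)) f"
    unfolding set_integrable_def
    by (rule borel_integrable_compact) (auto intro: continuous_on_subset[OF assms])
qed (use Omega0_subset_cbox in auto)

lemma integral_Omega0:
  fixes f :: "real \<times> real \<Rightarrow> real"
  assumes "continuous_on UNIV f"
  shows "(LINT x:Omega0|lborel. f x) = integral {-1..1} (\<lambda>u. integral {-1..1} (\<lambda>v. f (u, v)))"
proof -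
  have "(LINT x:Omega0|lborel. f x) = integral (cbox (-1, -1) (1, 1)) f"
    using set_borel_integral_eq_integral(2)[OF set_integrable_Omega0[OF assms]]
    by (simp add: Omega0_eq_box integral_open_interval)
  also have "\<dots> = integral {-1..1} (\<lambda>u. integral {-1..1} (\<lambda>v. f (u, v)))"
    using integral_prod_continuous[of "-1" "-1" 1 1 f] continuous_on_subset[OF assms] by simp
  finally show ?thesis .
qed

lemma integral_Omega0_swap:
  fixes f :: "real \<times> real \<Rightarrow> real"
  assumes "continuous_on UNIV f"
  shows "(LINT x:Omega0|lborel. f x) = integral {-1..1} (\<lambda>v. integral {-1..1} (\<lambda>u. f (u, v)))"
  using integral_swap_continuous[of "-1" "-1" 1 1 "\<lambda>u v. f (u, v)"] continuous_on_subset[OF assms]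
  by (simp add: integral_Omega0[OF assms])

lemma integral_odd:
  fixes g :: "real \<Rightarrow> real"
  assumes "\<And>x. g (- x) = - g x"
  shows "integral {-a..a} g = 0"
proof -
  \<comment> \<open>The reflection identity also covers a non-integrable \<open>g\<close>, since
    \<open>integral\<close> then has the default value 0 on both sides.\<close>
  have "integral {-a..a} g = integral {-a..a} (\<lambda>x. - g x)"
    using Henstock_Kurzweil_Integration.integral_reflect_real[of a "-a" g] unfolding assms by simp
  then show ?thesis by simp
qed

lemma integral_Omega0_odd_fst:
  fixes f :: "real \<times> real \<Rightarrow> real"
  assumes "continuous_on UNIV f" "\<And>u v. f (- u, v) = - f (u, v)"
  shows "(LINT x:Omega0|lborel. f x) = 0"
  by (simp add: integral_Omega0_swap assms integral_odd)

lemma integral_Omega0_odd_snd: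
  fixes f :: "real \<times> real \<Rightarrow> real"
  assumes "continuous_on UNIV f" "\<And>u v. f (u, - v) = - f (u, v)"
  shows "(LINT x:Omega0|lborel. f x) = 0"
  by (simp add: integral_Omega0 assms integral_odd)

section \<open>Partial derivatives of differentiable functions and of polynomials\<close>

lemma has_vector_derivative_along_line:
  assumes "(f has_derivative f') (at (x + t *\<^sub>R d))"
  shows "((\<lambda>t. f (x + t *\<^sub>R d)) has_vector_derivative f' d) (at t)"
proof -
  have "((\<lambda>t. x + t *\<^sub>R d) has_derivative (\<lambda>t. t *\<^sub>R d)) (at t)"
    by (rule derivative_eq_intros | simp)+
  from has_derivative_compose[OF this assms] linear_scale[OF has_derivative_linear[OF assms]]
  show ?thesis by (simp add: has_vector_derivative_def)
qed

lemma pderiv_at_eqI: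
  assumes "((\<lambda>t. f (x + t *\<^sub>R coord_dir i)) has_vector_derivative d) (at 0)"
  shows "pderiv_at i f x = d"
  using assms by (simp add: pderiv_at_def vector_derivative_at)

lemma pderiv_at_has_derivative:
  assumes "(f has_derivative f') (at x)"
  shows "pderiv_at i f x = f' (coord_dir i)"
  by (rule pderiv_at_eqI, rule has_vector_derivative_along_line) (use assms in simp)

lemma has_vector_derivative_along_coord:
  assumes "f differentiable at (x + t *\<^sub>R coord_dir i)"
  shows "((\<lambda>t. f (x + t *\<^sub>R coord_dir i)) has_vector_derivative pderiv_at i f (x + t *\<^sub>R coord_dir i)) (at t)"
proof -
  obtain f' where "(f has_derivative f') (at (x + t *\<^sub>R coord_dir i))"
    using assms by (auto simp: differentiable_def)
  then show ?thesis
    using has_vector_derivative_along_line pderiv_at_has_derivative by metis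
qed

text \<open>Induction over the generation of polynomials. The derivative is carried together with
  its polynomial dependence on the base point, so that partial derivatives can be iterated inside
  the class; the product case needs both facts.\<close>

lemma real_polynomial_function_has_derivative:
  fixes f :: "real \<times> real \<Rightarrow> real"
  assumes "real_polynomial_function f"
  shows "\<exists>f'. (\<forall>x. (f has_derivative f' x) (at x)) \<and> (\<forall>h. real_polynomial_function (\<lambda>x. f' x h))"
  using assms
proof induction
  case (linear f)
  then show ?case
    by (intro exI[of _ "\<lambda>_. f"]) (auto intro: bounded_linear_imp_has_derivative)
next
  case (const c)
  show ?case by (intro exI[of _ "\<lambda>_ _. 0"]) auto
next
  case (add f g)
  then obtain f' g' where "\<forall>x. (f has_derivative f' x) (at x)" "\<forall>h. real_polynomial_function (\<lambda>x. f' x h)"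
    "\<forall>x. (g has_derivative g' x) (at x)" "\<forall>h. real_polynomial_function (\<lambda>x. g' x h)" by blast
  then show ?case
    by (intro exI[of _ "\<lambda>x h. f' x h + g' x h"]) (auto intro!: has_derivative_add)
next
  case (mult f g)
  then obtain f' g' where f'g': "\<And>x. (f has_derivative f' x) (at x)" "\<And>h. real_polynomial_function (\<lambda>x. f' x h)"
    "\<And>x. (g has_derivative g' x) (at x)" "\<And>h. real_polynomial_function (\<lambda>x. g' x h)" by blast
  have "((\<lambda>x. f x * g x) has_derivative (\<lambda>h. f x * g' x h + f' x h * g x)) (at x)" for x
    by (intro has_derivative_mult f'g')
  moreover have "real_polynomial_function (\<lambda>x. f x * g' x h + f' x h * g x)" for h
    by (intro real_polynomial_function.intros(3,4) f'g' mult.hyps)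
  ultimately show ?case
    by (intro exI[of _ "\<lambda>x h. f x * g' x h + f' x h * g x"]) blast
qed

lemma real_polynomial_function_pderiv_at:
  assumes "real_polynomial_function f"
  shows "real_polynomial_function (pderiv_at i f)"
proof -
  obtain f' where f': "\<And>x. (f has_derivative f' x) (at x)" "\<And>h. real_polynomial_function (\<lambda>x. f' x h)"
    using real_polynomial_function_has_derivative[OF assms] by blast
  then have "pderiv_at i f = (\<lambda>x. f' x (coord_dir i))"
    by (auto simp: fun_eq_iff pderiv_at_has_derivative)
  with f' show ?thesis by simp
qed

lemma real_polynomial_function_differentiable:
  fixes f :: "real \<times> real \<Rightarrow> real"
  assumes "real_polynomial_function f"
  shows "f differentiable at x"
  using real_polynomial_function_has_derivative[OF assms] unfolding differentiable_def by blast

lemma real_polynomial_function_continuous_on: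
  fixes f :: "real \<times> real \<Rightarrow> real"
  assumes "real_polynomial_function f"
  shows "continuous_on S f"
  using real_polynomial_function_differentiable[OF assms]
  by (simp add: continuous_at_imp_continuous_on differentiable_imp_continuous_within)

lemma real_polynomial_function_smooth_on:
  assumes "real_polynomial_function f"
  shows "smooth_on \<Omega> f"
proof -
  \<comment> \<open>The claim is generalized over all polynomials because the step from
    \<open>k\<close> to \<open>Suc k\<close> passes to the partial derivatives.\<close>
  have "Ck_on k \<Omega> f" if "real_polynomial_function f" for k f
    using that
    by (induction k arbitrary: f)
      (auto simp: differentiable_on_def real_polynomial_function_continuous_on
        intro: differentiable_at_withinI real_polynomial_function_differentiable
          real_polynomial_function_pderiv_at)
  with assms show ?thesis by (simp add: smooth_on_def)
qed

section \<open>Boundedness, weak derivatives and admissibility of polynomials\<close>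

lemma real_polynomial_function_bounded_Omega0:
  assumes "real_polynomial_function f"
  shows "bounded (f ` Omega0)"
proof (rule bounded_subset)
  show "bounded (f ` cbox (-1, -1) (1, 1))"
    using compact_continuous_image[OF real_polynomial_function_continuous_on[OF assms] compact_cbox]
    by (rule compact_imp_bounded)
qed (use Omega0_subset_cbox in blast)

lemma real_polynomial_function_L2_Omega0:
  assumes "real_polynomial_function f"
  shows "f \<in> L2_on Omega0"
proof -
  have "continuous_on UNIV f"
    using assms by (rule real_polynomial_function_continuous_on)
  then have "set_integrable lborel Omega0 f" "set_integrable lborel Omega0 (\<lambda>x. (f x)\<^sup>2)"
    by (auto intro!: set_integrable_Omega0 continuous_intros)
  then show ?thesis
    by (auto simp: L2_on_def set_integrable_def set_borel_measurable_def)
qed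

text \<open>Fubini with the differentiated variable innermost, then the fundamental theorem of
  calculus. The boundary values vanish because the sides of the square lie outside the open set
  \<open>Omega0\<close>.\<close>

lemma integral_Omega0_pderiv_at_eq_0:
  fixes f :: "real \<times> real \<Rightarrow> real"
  assumes diff: "\<And>x. f differentiable at x" and cont: "continuous_on UNIV (pderiv_at i f)"
    and 0: "\<And>x. x \<notin> Omega0 \<Longrightarrow> f x = 0"
  shows "(LINT x:Omega0|lborel. pderiv_at i f x) = 0"
proof (cases "i = 1")
  case True
  have "((\<lambda>u. pderiv_at i f (u, v)) has_integral f (1, v) - f (-1, v)) {-1..1}" for v
  proof (rule fundamental_theorem_of_calculus)
    show "((\<lambda>u. f (u, v)) has_vector_derivative pderiv_at i f (u, v)) (at u within {-1..1})" for u
      using has_vector_derivative_along_coord[of f "(0, v)" u i] diff True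
      by (auto simp: coord_dir_def intro: has_vector_derivative_at_within)
  qed simp
  then have "integral {-1..1} (\<lambda>u. pderiv_at i f (u, v)) = 0" for v
    by (simp add: 0 Omega0_def integral_unique)
  then show ?thesis by (simp add: integral_Omega0_swap[OF cont])
next
  case False
  then have i: "i = 2" using exhaust_2 by blast
  have "((\<lambda>v. pderiv_at i f (u, v)) has_integral f (u, 1) - f (u, -1)) {-1..1}" for u
  proof (rule fundamental_theorem_of_calculus)
    show "((\<lambda>v. f (u, v)) has_vector_derivative pderiv_at i f (u, v)) (at v within {-1..1})" for v
      using has_vector_derivative_along_coord[of f "(u, 0)" v i] diff i
      by (auto simp: coord_dir_def intro: has_vector_derivative_at_within)
  qed simp
  then have "integral {-1..1} (\<lambda>v. pderiv_at i f (u, v)) = 0" for u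
    by (simp add: 0 Omega0_def integral_unique)
  then show ?thesis by (simp add: integral_Omega0[OF cont])
qed

lemma pderiv_at_mult:
  fixes f g :: "real \<times> real \<Rightarrow> real"
  assumes "f differentiable at x" "g differentiable at x"
  shows "pderiv_at i (\<lambda>x. f x * g x) x = f x * pderiv_at i g x + pderiv_at i f x * g x"
proof -
  obtain f' g' where "(f has_derivative f') (at x)" "(g has_derivative g') (at x)"
    using assms by (auto simp: differentiable_def)
  then show ?thesis
    using pderiv_at_has_derivative[OF has_derivative_mult] by (simp add: pderiv_at_has_derivative)
qed

text \<open>Integration by parts: the product of \<open>f\<close> with a test function vanishes off
  \<open>Omega0\<close>, so the integral of its partial derivative is 0, and the product rule splits
  that integral.\<close>

lemma real_polynomial_function_weak_pderiv:
  assumes f: "real_polynomial_function f"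
  shows "weak_pderiv Omega0 i f (pderiv_at i f)"
  unfolding weak_pderiv_def
proof
  fix \<psi> assume "\<psi> \<in> test_functions Omega0"
  then have "smooth_on UNIV \<psi>" and supp: "closure {x. \<psi> x \<noteq> 0} \<subseteq> Omega0"
    by (auto simp: test_functions_def)
  then have "Ck_on (Suc (Suc 0)) UNIV \<psi>" by (simp only: smooth_on_def)
  then have \<psi>: "\<psi> differentiable at x" and "pderiv_at i \<psi> differentiable at x" for x
    unfolding Ck_on.simps differentiable_on_def by blast+
  then have cont [continuous_intros]: "continuous_on UNIV \<psi>" "continuous_on UNIV (pderiv_at i \<psi>)"
    by (auto simp: continuous_at_imp_continuous_on differentiable_imp_continuous_within)
  note f_cont [continuous_intros] = real_polynomial_function_continuous_on[OF f]
    real_polynomial_function_continuous_on[OF real_polynomial_function_pderiv_at[OF f]]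
  note f_diff = real_polynomial_function_differentiable[OF f]
  have eq: "pderiv_at i (\<lambda>x. f x * \<psi> x) = (\<lambda>x. f x * pderiv_at i \<psi> x + pderiv_at i f x * \<psi> x)"
    by (auto simp: fun_eq_iff pderiv_at_mult f_diff \<psi>)
  have "(LINT x:Omega0|lborel. pderiv_at i (\<lambda>x. f x * \<psi> x) x) = 0"
  proof (rule integral_Omega0_pderiv_at_eq_0)
    show "f x * \<psi> x = 0" if "x \<notin> Omega0" for x
    proof -
      have "x \<notin> {x. \<psi> x \<noteq> 0}"
        using that supp closure_subset[of "{x. \<psi> x \<noteq> 0}"] by blast
      then show ?thesis by simp
    qed
  qed (auto simp: eq f_diff \<psi> intro!: continuous_intros)
  moreover have "(LINT x:Omega0|lborel. pderiv_at i (\<lambda>x. f x * \<psi> x) x)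
      = (LINT x:Omega0|lborel. f x * pderiv_at i \<psi> x) + (LINT x:Omega0|lborel. pderiv_at i f x * \<psi> x)"
    unfolding eq by (intro set_integral_add set_integrable_Omega0 continuous_intros)
  ultimately show "(LINT x:Omega0|lborel. f x * pderiv_at i \<psi> x) = - (LINT x:Omega0|lborel. pderiv_at i f x * \<psi> x)"
    by simp
qed

lemma real_polynomial_function_admissible:
  assumes "real_polynomial_function f"
  shows "f \<in> admissible Omega0"
proof -
  note P = real_polynomial_function_pderiv_at
  have "f \<in> H1 Omega0"
    using real_polynomial_function_L2_Omega0 real_polynomial_function_weak_pderiv P assms
    unfolding H1_def by blast
  then show ?thesis
    unfolding admissible_def
    using real_polynomial_function_smooth_on[OF assms] real_polynomial_function_bounded_Omega0 assms
      P[OF assms] P[OF P[OF assms]] by blast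
qed

section \<open>Differential geometry of the Scherk patch\<close>

definition cpx :: "real \<times> real \<Rightarrow> complex" where
  "cpx = (\<lambda>(u, v). Complex u v)"

definition weier_h :: "complex \<Rightarrow> complex" where
  "weier_h z = 2 / (z ^ 4 - 1)"

definition weier_psi :: "3 \<Rightarrow> complex \<Rightarrow> complex" where
  "weier_psi k z = (vector [1 - z\<^sup>2, \<i> * (1 + z\<^sup>2), - 2 * z] :: complex^3) $ k"

definition weier_psi' :: "3 \<Rightarrow> complex \<Rightarrow> complex" where
  "weier_psi' k z = (vector [- 2 * z, 2 * \<i> * z, - 2] :: complex^3) $ k"

text \<open>The removed circle is the zero set of the arctan denominators in
  \<open>scherk\<close>.\<close>

definition scherk_dom :: "(real \<times> real) set" where
  "scherk_dom = Omega0 - sphere 0 1"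

lemma norm_Pair_eq_1_iff: "norm (u, v) = 1 \<longleftrightarrow> u\<^sup>2 + v\<^sup>2 = 1" for u v :: real
  by (simp add: norm_Pair)

lemma mem_Omega0_iff: "(u, v) \<in> Omega0 \<longleftrightarrow> \<bar>u\<bar> < 1 \<and> \<bar>v\<bar> < 1"
  by (auto simp: Omega0_def)

lemma open_scherk_dom: "open scherk_dom"
  by (auto simp: scherk_dom_def Omega0_eq_box intro!: open_Diff)

lemma has_vector_derivative_vector_3:
  assumes "(a has_real_derivative a') (at t)" "(b has_real_derivative b') (at t)" "(c has_real_derivative c') (at t)"
  shows "((\<lambda>t. vector [a t, b t, c t] :: real^3) has_vector_derivative vector [a', b', c']) (at t)"
  using assms unfolding has_vector_derivative_def
  by (subst has_derivative_componentwise_within)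
    (auto simp: Basis_vec_def inner_axis forall_3 has_field_derivative_def mult_commute_abs)

lemma has_real_derivative_arctan_divide:
  assumes "(N has_real_derivative N') (at t)" "(D has_real_derivative D') (at t)" "D t \<noteq> 0"
  shows "((\<lambda>t. arctan (N t / D t)) has_real_derivative
    (N' * D t - N t * D') / ((D t)\<^sup>2 + (N t)\<^sup>2)) (at t)"
proof -
  have "(D t)\<^sup>2 + (N t)\<^sup>2 > 0"
    using assms(3) by (simp add: sum_power2_gt_zero_iff)
  then have "(N' * D t - N t * D') / (D t * D t) * inverse (1 + (N t / D t)\<^sup>2)
      = (N' * D t - N t * D') / ((D t)\<^sup>2 + (N t)\<^sup>2)"
    using assms(3) by (simp add: divide_simps power2_eq_square)
  moreover have "((\<lambda>t. arctan (N t / D t)) has_real_derivative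
    (N' * D t - N t * D') / (D t * D t) * inverse (1 + (N t / D t)\<^sup>2)) (at t)"
    using DERIV_chain2[OF DERIV_arctan DERIV_divide[OF assms]] by (simp add: mult.commute)
  ultimately show ?thesis by simp
qed

lemma has_real_derivative_ln_sqrt_divide:
  assumes "(A has_real_derivative A') (at t)" "(B has_real_derivative B') (at t)" "A t > 0" "B t > 0"
  shows "((\<lambda>t. ln (sqrt (A t / B t))) has_real_derivative (A' / A t - B' / B t) / 2) (at t)"
proof -
  have deriv: "((\<lambda>t. (ln (A t) - ln (B t)) / 2) has_real_derivative (A' / A t - B' / B t) / 2) (at t)"
    using assms by (auto intro!: derivative_eq_intros simp: mult.commute)
  \<comment> \<open>The logarithm splits only where \<open>A\<close> and \<open>B\<close> are
    positive, hence only near \<open>t\<close>; this is enough for the derivative.\<close>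
  have "\<forall>\<^sub>F t in nhds t. 0 < A t" "\<forall>\<^sub>F t in nhds t. 0 < B t"
    using assms order_tendstoD(1)[of A "A t" "nhds t" 0] order_tendstoD(1)[of B "B t" "nhds t" 0]
      DERIV_isCont isCont_def continuous_at tendsto_at_iff_tendsto_nhds by metis+
  then have ev: "\<forall>\<^sub>F t in nhds t. ln (sqrt (A t / B t)) = (ln (A t) - ln (B t)) / 2"
    by eventually_elim (simp add: ln_sqrt ln_div)
  show ?thesis
    by (rule iffD2[OF DERIV_cong_ev[OF refl ev refl] deriv])
qed

text \<open>The poles of \<open>weier_h\<close> are the fourth roots of unity, the midpoints of the
  sides of the square. At such a point the real part u^2 - v^2 of z^2 would be 1 or -1, impossible
  in the open square.\<close>

lemma scherk_dom_sq_neq: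
  assumes "x \<in> scherk_dom"
  shows "(cpx x)\<^sup>2 \<noteq> 1" "(cpx x)\<^sup>2 \<noteq> -1" "(cpx x)^4 \<noteq> 1"
proof -
  obtain u v where x: "x = (u, v)" by (cases x)
  have uv: "\<bar>u\<bar> < 1" "\<bar>v\<bar> < 1"
    using assms by (auto simp: x scherk_dom_def mem_Omega0_iff)
  then have "u\<^sup>2 < 1" "v\<^sup>2 < 1"
    by (simp_all add: abs_square_less_1)
  then have "u\<^sup>2 - v\<^sup>2 \<noteq> 1" "u\<^sup>2 - v\<^sup>2 \<noteq> -1"
    using zero_le_power2[of u] zero_le_power2[of v] by linarith+
  then show *: "(cpx x)\<^sup>2 \<noteq> 1" "(cpx x)\<^sup>2 \<noteq> -1"
    by (auto simp: x cpx_def complex_eq_iff Re_power2)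
  have "(cpx x)^4 - 1 = ((cpx x)\<^sup>2 - 1) * ((cpx x)\<^sup>2 + 1)"
    by algebra
  then show "(cpx x)^4 \<noteq> 1"
    using * by (auto simp: eq_neg_iff_add_eq_0)
qed

text \<open>The real derivatives of the three coordinates are matched with the partial fractions of
  \<open>weier_h z * weier_psi k z\<close>, whose denominators are z^2 + 1 and z^2 - 1. An arbitrary
  direction \<open>d\<close> treats both partial derivatives at once.\<close>

lemma scherk_has_vector_derivative:
  assumes "x \<in> scherk_dom"
  shows "((\<lambda>t. scherk (x + t *\<^sub>R d)) has_vector_derivative
     (\<chi> k. Re (weier_h (cpx x) * weier_psi k (cpx x) * cpx d))) (at 0)"
proof -
  obtain u v p q where x: "x = (u, v)" and d: "d = (p, q)" by (cases x, cases d)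
  define z where "z = cpx x"
  define w where "w = cpx d"
  define A where "A = (u\<^sup>2 - v\<^sup>2 + 1)\<^sup>2 + 4 * u\<^sup>2 * v\<^sup>2"
  define B where "B = (u\<^sup>2 - v\<^sup>2 - 1)\<^sup>2 + 4 * u\<^sup>2 * v\<^sup>2"
  have D: "u\<^sup>2 + v\<^sup>2 - 1 \<noteq> 0"
    using assms by (simp add: x scherk_dom_def norm_Pair_eq_1_iff)
  have nz: "z\<^sup>2 \<noteq> 1" "z\<^sup>2 \<noteq> -1" "z^4 \<noteq> 1"
    using scherk_dom_sq_neq[OF assms] by (simp_all add: z_def)
  have norms: "A = (cmod (z\<^sup>2 + 1))\<^sup>2" "B = (cmod (z\<^sup>2 - 1))\<^sup>2"
    by (simp_all add: A_def B_def z_def x cpx_def cmod_power2 Re_power2 Im_power2 power_mult_distrib)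
  have pos: "A > 0" "B > 0"
    using nz by (auto simp: norms eq_neg_iff_add_eq_0)
  define G where "G k = weier_h z * weier_psi k z * w" for k
  have "G 1 = - 2 * w / (z\<^sup>2 + 1)" "G 2 = 2 * \<i> * w / (z\<^sup>2 - 1)"
    "G 3 = 2 * z * w / (z\<^sup>2 + 1) - 2 * z * w / (z\<^sup>2 - 1)"
    using nz by (simp_all add: G_def weier_h_def weier_psi_def eq_neg_iff_add_eq_0 divide_simps, algebra+)
  \<comment> \<open>Extending each fraction by the conjugate denominator turns the denominators into
    the real numbers \<open>A\<close> and \<open>B\<close>, so that real parts can be taken in the
    numerators.\<close>
  then have G: "Re (G 1) = Re (- 2 * w * cnj (z\<^sup>2 + 1)) / A"
    "Re (G 2) = Re (2 * \<i> * w * cnj (z\<^sup>2 - 1)) / B"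
    "Re (G 3) = Re (2 * z * w * cnj (z\<^sup>2 + 1)) / A - Re (2 * z * w * cnj (z\<^sup>2 - 1)) / B"
    by (simp_all only: norms complex_div_cnj[of _ "z\<^sup>2 + 1"] complex_div_cnj[of _ "z\<^sup>2 - 1"] minus_complex.sel
        Re_divide_of_real of_real_power[symmetric])
  note coords = z_def w_def x d cpx_def Re_power2 Im_power2
  let ?D = "\<lambda>t. (u + t * p)\<^sup>2 + (v + t * q)\<^sup>2 - 1"
  let ?A = "\<lambda>t. ((u + t * p)\<^sup>2 - (v + t * q)\<^sup>2 + 1)\<^sup>2 + 4 * (u + t * p)\<^sup>2 * (v + t * q)\<^sup>2"
  let ?B = "\<lambda>t. ((u + t * p)\<^sup>2 - (v + t * q)\<^sup>2 - 1)\<^sup>2 + 4 * (u + t * p)\<^sup>2 * (v + t * q)\<^sup>2"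
  have D0: "?D 0 \<noteq> 0" and AB0: "?A 0 > 0" "?B 0 > 0"
    using D pos by (simp_all add: A_def B_def)
  have D': "(?D has_real_derivative 2 * u * p + 2 * v * q) (at 0)"
    by (auto intro!: derivative_eq_intros)
  have A': "(?A has_real_derivative 2 * (u\<^sup>2 - v\<^sup>2 + 1) * (2 * u * p - 2 * v * q) + 8 * u * p * v\<^sup>2 + 8 * u\<^sup>2 * v * q) (at 0)"
    by (auto intro!: derivative_eq_intros simp: algebra_simps)
  have B': "(?B has_real_derivative 2 * (u\<^sup>2 - v\<^sup>2 - 1) * (2 * u * p - 2 * v * q) + 8 * u * p * v\<^sup>2 + 8 * u\<^sup>2 * v * q) (at 0)"
    by (auto intro!: derivative_eq_intros simp: algebra_simps)
  have "((\<lambda>t. 2 * (u + t * p)) has_real_derivative 2 * p) (at 0)"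
    by (auto intro!: derivative_eq_intros)
  from has_real_derivative_arctan_divide[OF this D' D0]
  have 1: "((\<lambda>t. arctan (2 * (u + t * p) / ?D t)) has_real_derivative Re (G 1)) (at 0)"
  proof (rule DERIV_cong)
    \<comment> \<open>The denominator produced by the arctan rule is |z^2 + 1|^2 in another form;
      for the second coordinate it is |z^2 - 1|^2.\<close>
    have "(u\<^sup>2 + v\<^sup>2 - 1)\<^sup>2 + (2 * u)\<^sup>2 = A"
      unfolding A_def by algebra
    then show "(2 * p * ?D 0 - 2 * (u + 0 * p) * (2 * u * p + 2 * v * q)) / ((?D 0)\<^sup>2 + (2 * (u + 0 * p))\<^sup>2) = Re (G 1)"
      unfolding G by (simp add: coords) (simp add: algebra_simps power2_eq_square)?
  qed
  have "((\<lambda>t. - 2 * (v + t * q)) has_real_derivative - 2 * q) (at 0)"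
    by (auto intro!: derivative_eq_intros)
  from has_real_derivative_arctan_divide[OF this D' D0]
  have 2: "((\<lambda>t. arctan (- 2 * (v + t * q) / ?D t)) has_real_derivative Re (G 2)) (at 0)"
  proof (rule DERIV_cong)
    have "(u\<^sup>2 + v\<^sup>2 - 1)\<^sup>2 + (2 * v)\<^sup>2 = B"
      unfolding B_def by algebra
    then show "(- 2 * q * ?D 0 - - 2 * (v + 0 * q) * (2 * u * p + 2 * v * q)) / ((?D 0)\<^sup>2 + (- 2 * (v + 0 * q))\<^sup>2) = Re (G 2)"
      unfolding G by (simp add: coords) (simp add: algebra_simps power2_eq_square)?
  qed
  from has_real_derivative_ln_sqrt_divide[OF A' B' AB0]
  have 3: "((\<lambda>t. ln (sqrt (?A t / ?B t))) has_real_derivative Re (G 3)) (at 0)"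
  proof (rule DERIV_cong)
    \<comment> \<open>The fractions over \<open>A\<close> and over \<open>B\<close> agree
      separately, so only their polynomial numerators are compared.\<close>
    have "Re (G 3) = (2 * (u\<^sup>2 - v\<^sup>2 + 1) * (2 * u * p - 2 * v * q) + 8 * u * p * v\<^sup>2 + 8 * u\<^sup>2 * v * q) / 2 / A
      - (2 * (u\<^sup>2 - v\<^sup>2 - 1) * (2 * u * p - 2 * v * q) + 8 * u * p * v\<^sup>2 + 8 * u\<^sup>2 * v * q) / 2 / B"
      unfolding G
      by (intro arg_cong2[where f = "(-)"] arg_cong2[where f = "(/)"] refl)
        (simp_all add: coords algebra_simps power2_eq_square)
    moreover have AB: "?A 0 = A" "?B 0 = B"
      by (simp_all add: A_def B_def)
    ultimately show "((2 * (u\<^sup>2 - v\<^sup>2 + 1) * (2 * u * p - 2 * v * q) + 8 * u * p * v\<^sup>2 + 8 * u\<^sup>2 * v * q) / ?A 0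
      - (2 * (u\<^sup>2 - v\<^sup>2 - 1) * (2 * u * p - 2 * v * q) + 8 * u * p * v\<^sup>2 + 8 * u\<^sup>2 * v * q) / ?B 0) / 2 = Re (G 3)"
      unfolding AB by (simp only: diff_divide_distrib divide_divide_eq_left mult.commute[of 2])
  qed
  have "(\<chi> k. Re (G k)) = (vector [Re (G 1), Re (G 2), Re (G 3)] :: real^3)"
    by (simp add: vec_eq_iff forall_3)
  moreover have "scherk (x + t *\<^sub>R d)
      = vector [arctan (2 * (u + t * p) / ?D t), arctan (- 2 * (v + t * q) / ?D t), ln (sqrt (?A t / ?B t))]" for t
    by (simp only: scherk_def x d scaleR_Pair add_Pair real_scaleR_def prod.case)
  ultimately show ?thesis
    using has_vector_derivative_vector_3[OF 1 2 3] unfolding z_def[symmetric] w_def[symmetric] G_def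
    by (simp only:)
qed

lemma cpx_add_scaleR: "cpx (x + t *\<^sub>R d) = cpx x + of_real t * cpx d"
  by (cases x; cases d) (simp add: cpx_def complex_eq_iff)

lemma pderiv_scherk:
  assumes "x \<in> scherk_dom"
  shows "pderiv_at i scherk x = (\<chi> k. Re (weier_h (cpx x) * weier_psi k (cpx x) * cpx (coord_dir i)))"
  by (intro pderiv_at_eqI scherk_has_vector_derivative assms)

lemma has_real_derivative_Re_along_line:
  assumes "(F has_field_derivative F') (at (cpx x))"
  shows "((\<lambda>t. Re (F (cpx (x + t *\<^sub>R d)))) has_real_derivative Re (F' * cpx d)) (at 0)"
proof -
  have "((\<lambda>t. cpx x + of_real t * cpx d) has_vector_derivative cpx d) (at 0)"
    by (auto intro!: derivative_eq_intros)
  from field_vector_diff_chain_at[OF this, of F F'] assms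
  have "((\<lambda>t. F (cpx x + of_real t * cpx d)) has_vector_derivative cpx d * F') (at 0)"
    by (simp add: o_def)
  from bounded_linear.has_vector_derivative[OF bounded_linear_Re this] show ?thesis
    by (simp add: has_real_derivative_iff_has_vector_derivative cpx_add_scaleR mult.commute)
qed

lemma weier_psi_has_field_derivative: "(weier_psi k has_field_derivative weier_psi' k z) (at z)"
proof -
  have "\<forall>k. (weier_psi k has_field_derivative weier_psi' k z) (at z)"
    unfolding forall_3 weier_psi_def weier_psi'_def vector_3
    by (intro conjI) (rule derivative_eq_intros refl | simp)+
  then show ?thesis by blast
qed

lemma weier_h_has_field_derivative:
  assumes "z ^ 4 \<noteq> 1"
  shows "(weier_h has_field_derivative deriv weier_h z) (at z)"
proof -
  have "weier_h field_differentiable at z"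
    unfolding weier_h_def using assms by (intro derivative_intros) auto
  then show ?thesis by (simp add: DERIV_deriv_iff_field_differentiable)
qed

text \<open>The first derivatives are real parts of holomorphic functions along the line, so the
  complex chain rule applies. \<open>deriv weier_h\<close> stays unevaluated because it multiplies
  \<open>weier_psi\<close>, which the normal annihilates.\<close>

lemma pderiv2_scherk:
  assumes x: "x \<in> scherk_dom"
  shows "pderiv_at i (pderiv_at j scherk) x = (\<chi> k. Re
    ((deriv weier_h (cpx x) * weier_psi k (cpx x) + weier_h (cpx x) * weier_psi' k (cpx x))
      * cpx (coord_dir j) * cpx (coord_dir i)))"
proof (rule pderiv_at_eqI)
  define wi where "wi = cpx (coord_dir i)"
  define wj where "wj = cpx (coord_dir j)"
  let ?F = "\<lambda>k z. weier_h z * weier_psi k z * wj"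
  let ?F' = "\<lambda>k z. (deriv weier_h z * weier_psi k z + weier_h z * weier_psi' k z) * wj"
  have "(?F k has_field_derivative ?F' k (cpx x)) (at (cpx x))" for k
    using weier_h_has_field_derivative[OF scherk_dom_sq_neq(3)[OF x]] weier_psi_has_field_derivative
    by (auto intro!: derivative_eq_intros simp: algebra_simps)
  then have D: "((\<lambda>t. Re (?F k (cpx (x + t *\<^sub>R coord_dir i)))) has_real_derivative Re (?F' k (cpx x) * wi)) (at 0)" for k
    unfolding wi_def by (rule has_real_derivative_Re_along_line)
  have vec: "(\<chi> k. f k) = (vector [f 1, f 2, f 3] :: real^3)" for f
    by (simp add: vec_eq_iff forall_3)
  have deriv: "((\<lambda>t. \<chi> k. Re (?F k (cpx (x + t *\<^sub>R coord_dir i)))) has_vector_derivative (\<chi> k. Re (?F' k (cpx x) * wi))) (at 0)"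
    unfolding vec by (intro has_vector_derivative_vector_3 D)
  \<comment> \<open>The formula for the first derivative holds only on \<open>scherk_dom\<close>; by
    openness the line stays there for small \<open>t\<close>.\<close>
  have "open ((\<lambda>t. x + t *\<^sub>R coord_dir i) -` scherk_dom)"
    by (intro open_vimage open_scherk_dom continuous_intros)
  from has_vector_derivative_transform_within_open[OF deriv this]
  show "((\<lambda>t. pderiv_at j scherk (x + t *\<^sub>R coord_dir i)) has_vector_derivative
      (\<chi> k. Re ((deriv weier_h (cpx x) * weier_psi k (cpx x) + weier_h (cpx x) * weier_psi' k (cpx x))
        * cpx (coord_dir j) * cpx (coord_dir i)))) (at 0)"
    using x by (simp add: pderiv_scherk wi_def wj_def)
qed

section \<open>Metric, normal and second fundamental form\<close>

definition scherk_normal :: "real \<times> real \<Rightarrow> real^3" where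
  "scherk_normal = (\<lambda>(u, v). vector [- 2 * u, - 2 * v, u\<^sup>2 + v\<^sup>2 - 1])"

lemma inner_vec_3: "x \<bullet> y = x $ 1 * y $ 1 + x $ 2 * y $ 2 + x $ 3 * y $ 3" for x y :: "real^3"
  by (simp add: inner_vec_def sum_3)

lemma cpx_coord_dir: "cpx (coord_dir 1) = 1" "cpx (coord_dir 2) = \<i>"
  by (simp_all add: cpx_def coord_dir_def complex_eq_iff)

lemma weier_psi_Pair:
  "weier_psi 1 (cpx (u, v)) = Complex (1 - u\<^sup>2 + v\<^sup>2) (- 2 * u * v)"
  "weier_psi 2 (cpx (u, v)) = Complex (- 2 * u * v) (1 + u\<^sup>2 - v\<^sup>2)"
  "weier_psi 3 (cpx (u, v)) = Complex (- 2 * u) (- 2 * v)"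
  by (simp_all add: weier_psi_def cpx_def complex_eq_iff Re_power2 Im_power2)

lemma weier_psi'_Pair:
  "weier_psi' 1 (cpx (u, v)) = Complex (- 2 * u) (- 2 * v)"
  "weier_psi' 2 (cpx (u, v)) = Complex (- 2 * v) (2 * u)"
  "weier_psi' 3 (cpx (u, v)) = Complex (- 2) 0"
  by (simp_all add: weier_psi'_def cpx_def complex_eq_iff)

definition conf_factor :: "real \<times> real \<Rightarrow> real" where
  "conf_factor x = (cmod (weier_h (cpx x)))\<^sup>2 * (1 + (norm x)\<^sup>2)\<^sup>2"

lemma norm_Pair_power2: "(norm (u, v))\<^sup>2 = u\<^sup>2 + v\<^sup>2" for u v :: real
  by (simp add: norm_Pair)

lemma conf_factor_pos:
  assumes "x \<in> scherk_dom"
  shows "conf_factor x > 0"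
proof -
  have "weier_h (cpx x) \<noteq> 0"
    using scherk_dom_sq_neq(3)[OF assms] by (simp add: weier_h_def)
  moreover have "1 + (norm x)\<^sup>2 > 0"
    by (simp add: add_pos_nonneg)
  ultimately show ?thesis
    by (simp add: conf_factor_def)
qed

text \<open>Written with the real and imaginary parts of \<open>weier_h\<close> as parameters,
  metric and normal become polynomial identities in \<open>a\<close>, \<open>b\<close>,
  \<open>u\<close>, \<open>v\<close>.\<close>

lemma pderiv_scherk_components:
  assumes "(u, v) \<in> scherk_dom"
  defines "a \<equiv> Re (weier_h (cpx (u, v)))" and "b \<equiv> Im (weier_h (cpx (u, v)))"
  shows "pderiv_at 1 scherk (u, v) =
      vector [a * (1 - u\<^sup>2 + v\<^sup>2) + 2 * b * u * v, - 2 * a * u * v - b * (1 + u\<^sup>2 - v\<^sup>2), - 2 * a * u + 2 * b * v]"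
    and "pderiv_at 2 scherk (u, v) =
      vector [2 * a * u * v - b * (1 - u\<^sup>2 + v\<^sup>2), - a * (1 + u\<^sup>2 - v\<^sup>2) + 2 * b * u * v, 2 * a * v + 2 * b * u]"
  using assms(1)
  by (simp_all add: pderiv_scherk cpx_coord_dir weier_psi_Pair vec_eq_iff forall_3 a_def b_def algebra_simps)

text \<open>In complex terms: the squares of the components of \<psi> sum to 0, which gives
  conformality, and the squares of their moduli sum to 2 (1 + |z|^2)^2, which gives the
  factor.\<close>

lemma first_form_scherk:
  assumes "x \<in> scherk_dom"
  shows "first_form scherk x = mat (conf_factor x)"
proof -
  obtain u v where x: "x = (u, v)" by (cases x)
  show ?thesis
    using assms unfolding x
    by (simp add: first_form_def mat_def vec_eq_iff forall_2 inner_vec_3 pderiv_scherk_components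
        conf_factor_def norm_Pair_power2 cmod_power2) algebra
qed

text \<open>The Gauss map is \<open>- z\<close>; its inverse stereographic projection scaled by 1 +
  |z|^2 is \<open>scherk_normal\<close>. The cross product is a positive multiple of that vector, so
  normalizing keeps its direction.\<close>

lemma unit_normal_scherk:
  assumes "x \<in> scherk_dom"
  shows "unit_normal scherk x = scherk_normal x /\<^sub>R (1 + (norm x)\<^sup>2)"
proof -
  obtain u v where x: "x = (u, v)" by (cases x)
  define s where "s = 1 + (norm x)\<^sup>2"
  define m where "m = (cmod (weier_h (cpx x)))\<^sup>2"
  have s: "s = 1 + u\<^sup>2 + v\<^sup>2" "s > 0"
    by (simp_all add: s_def x norm_Pair_power2 add_pos_nonneg)
  have m: "m = (Re (weier_h (cpx x)))\<^sup>2 + (Im (weier_h (cpx x)))\<^sup>2"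
    by (simp add: m_def cmod_power2)
  have "conf_factor x > 0"
    using assms by (rule conf_factor_pos)
  then have "m > 0"
    using s by (simp add: conf_factor_def m_def s_def zero_less_mult_iff)
  have cross: "cross3 (pderiv_at 1 scherk x) (pderiv_at 2 scherk x) = (m * s) *\<^sub>R scherk_normal x"
    using assms unfolding x m s
    by (simp add: cross3_def vec_eq_iff forall_3 pderiv_scherk_components scherk_normal_def) algebra
  have "scherk_normal x \<bullet> scherk_normal x = s\<^sup>2"
    unfolding x s by (simp add: scherk_normal_def inner_vec_3) algebra
  then have "norm (scherk_normal x) = s"
    using s by (simp add: norm_eq_sqrt_inner)
  then show ?thesis
    using \<open>s > 0\<close> \<open>m > 0\<close> unfolding unit_normal_def cross Let_def s_def[symmetric]
    by (simp add: field_simps)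
qed

text \<open>The normal field pairs with \<psi> to 0 and with the derivative of \<psi> to 2 (1 +
  |z|^2). Thus the derivative of h drops out and the normalization of the normal cancels.\<close>

lemma second_form_scherk:
  assumes "x \<in> scherk_dom"
  shows "second_form scherk x $ i $ j = 2 * Re (weier_h (cpx x) * cpx (coord_dir j) * cpx (coord_dir i))"
proof -
  obtain u v where x: "x = (u, v)" by (cases x)
  define z where "z = cpx x"
  define s where "s = 1 + (norm x)\<^sup>2"
  \<comment> \<open>The normal is embedded in the complex numbers so that its real inner product
    with real parts is the real part of one complex bilinear sum.\<close>
  define n where "n k = complex_of_real (scherk_normal x $ k)" for k
  define w where "w = cpx (coord_dir j) * cpx (coord_dir i)"
  have s: "s = 1 + u\<^sup>2 + v\<^sup>2" "s > 0"
    by (simp_all add: s_def x norm_Pair_power2 add_pos_nonneg)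
  define c where "c k = (deriv weier_h z * weier_psi k z + weier_h z * weier_psi' k z) * w" for k
  have "n 1 * weier_psi 1 z + n 2 * weier_psi 2 z + n 3 * weier_psi 3 z = 0"
    by (simp add: z_def x n_def weier_psi_Pair scherk_normal_def complex_eq_iff) algebra
  moreover have "n 1 * weier_psi' 1 z + n 2 * weier_psi' 2 z + n 3 * weier_psi' 3 z = of_real (2 * s)"
    unfolding s by (simp add: z_def x n_def weier_psi'_Pair scherk_normal_def complex_eq_iff) algebra
  moreover have "n 1 * c 1 + n 2 * c 2 + n 3 * c 3
     = (deriv weier_h z * (n 1 * weier_psi 1 z + n 2 * weier_psi 2 z + n 3 * weier_psi 3 z)
       + weier_h z * (n 1 * weier_psi' 1 z + n 2 * weier_psi' 2 z + n 3 * weier_psi' 3 z)) * w"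
    by (simp add: c_def algebra_simps)
  ultimately have "n 1 * c 1 + n 2 * c 2 + n 3 * c 3 = of_real (2 * s) * (weier_h z * w)"
    by (simp only: mult_zero_right add_0 mult.assoc mult.left_commute)
  then have "Re (n 1 * c 1 + n 2 * c 2 + n 3 * c 3) = 2 * s * Re (weier_h z * w)"
    by simp
  moreover have "pderiv_at i (pderiv_at j scherk) x $ k = Re (c k)" for k
    using assms by (simp only: pderiv2_scherk c_def w_def z_def mult.assoc vec_lambda_beta)
  then have "second_form scherk x $ i $ j = Re (n 1 * c 1 + n 2 * c 2 + n 3 * c 3) / s"
    using assms \<open>s > 0\<close>
    by (simp add: second_form_def unit_normal_scherk inner_vec_3 n_def s_def[symmetric] field_simps)
  ultimately show ?thesis
    using \<open>s > 0\<close> by (simp add: z_def[symmetric] w_def mult.assoc)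
qed

section \<open>The second variation as the integral of an explicit density\<close>

lemma matrix_inv_mat:
  fixes c :: real
  assumes "c \<noteq> 0"
  shows "matrix_inv (mat c :: real^'n^'n) = mat (1 / c)"
proof -
  have *: "mat c ** mat (1 / c) = (mat 1 :: real^'n^'n)" "mat (1 / c) ** mat c = (mat 1 :: real^'n^'n)"
    using assms by (auto simp: matrix_matrix_mult_def mat_def vec_eq_iff if_distrib[of "\<lambda>x. x * _"] cong: if_cong)
  \<comment> \<open>\<open>matrix_inv\<close> is a choice among two-sided inverses, so its value
    follows from their uniqueness.\<close>
  have "A' = mat (1 / c)" if "mat c ** A' = mat 1" for A' :: "real^'n^'n"
    by (metis * matrix_mul_assoc matrix_mul_lid matrix_mul_rid that)
  then show ?thesis
    unfolding matrix_inv_def by (intro some_equality conjI *) blast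
qed

lemma one_plus_norm_power2_neq_0: "1 + (norm x)\<^sup>2 \<noteq> 0" for x :: "'a::real_normed_vector"
  using zero_le_power2[of "norm x"] by linarith

text \<open>The polarized density of Q, in two arguments so that the mixed terms of linear
  combinations can be named and integrated by parity.\<close>

definition index_form :: "(real \<times> real \<Rightarrow> real) \<Rightarrow> (real \<times> real \<Rightarrow> real) \<Rightarrow> real \<times> real \<Rightarrow> real" where
  "index_form \<phi> \<psi> x = pderiv_at 1 \<phi> x * pderiv_at 1 \<psi> x + pderiv_at 2 \<phi> x * pderiv_at 2 \<psi> x
     - 8 * \<phi> x * \<psi> x / (1 + (norm x)\<^sup>2)\<^sup>2"

lemma continuous_on_index_form [continuous_intros]:
  assumes "real_polynomial_function \<phi>" "real_polynomial_function \<psi>"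
  shows "continuous_on S (index_form \<phi> \<psi>)"
  unfolding index_form_def
  by (intro continuous_intros real_polynomial_function_continuous_on real_polynomial_function_pderiv_at
      assms ballI) (simp add: one_plus_norm_power2_neq_0)

definition second_variation_integrand :: "patch \<Rightarrow> (real \<times> real \<Rightarrow> real) \<Rightarrow> real \<times> real \<Rightarrow> real" where
  "second_variation_integrand \<sigma> \<phi> x =
     ((\<Sum>i\<in>UNIV. \<Sum>j\<in>UNIV. matrix_inv (first_form \<sigma> x) $ i $ j * pderiv_at i \<phi> x * pderiv_at j \<phi> x)
       + 2 * gauss_curvature \<sigma> x * (\<phi> x)\<^sup>2) * sqrt (det (first_form \<sigma> x))"

text \<open>In dimension two the gradient term is conformally invariant. Curvature times area
  density is - 4 |h|^2 / E with E = |h|^2 (1 + |z|^2)^2, so |h|^2 cancels.\<close>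

lemma second_variation_integrand_scherk_dom:
  assumes "x \<in> scherk_dom"
  shows "second_variation_integrand scherk \<phi> x = index_form \<phi> \<phi> x"
proof -
  define E where "E = conf_factor x"
  define m where "m = (cmod (weier_h (cpx x)))\<^sup>2"
  define s where "s = 1 + (norm x)\<^sup>2"
  have E: "E > 0" "E = m * s\<^sup>2"
    using conf_factor_pos[OF assms] by (simp_all add: E_def conf_factor_def m_def s_def)
  then have ms: "m \<noteq> 0" "s \<noteq> 0" by auto
  have form: "first_form scherk x = mat E"
    using assms by (simp add: first_form_scherk E_def)
  have inv: "matrix_inv (mat E :: real^2^2) = mat (1 / E)"
    using E(1) by (simp add: matrix_inv_mat)
  have det: "det (mat E :: real^2^2) = E\<^sup>2"
    by (simp add: det_2 mat_def power2_eq_square)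
  have "m = (Re (weier_h (cpx x)))\<^sup>2 + (Im (weier_h (cpx x)))\<^sup>2"
    by (simp add: m_def cmod_power2)
  \<comment> \<open>With h = a + i b the second form has rows (2 a, - 2 b) and (- 2 b, - 2
    a).\<close>
  then have "det (second_form scherk x) = - 4 * m"
    using assms by (simp add: det_2 second_form_scherk cpx_coord_dir power2_eq_square)
  then have curv: "gauss_curvature scherk x = - 4 * m / E\<^sup>2"
    by (simp add: gauss_curvature_def form det)
  have "second_variation_integrand scherk \<phi> x
      = ((pderiv_at 1 \<phi> x)\<^sup>2 / E + (pderiv_at 2 \<phi> x)\<^sup>2 / E + 2 * (- 4 * m / E\<^sup>2) * (\<phi> x)\<^sup>2) * E"
    using inv E(1) unfolding second_variation_integrand_def form curv det sum_2
    by (simp add: mat_def power2_eq_square[of "pderiv_at _ \<phi> x"])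
  also have "\<dots> = (pderiv_at 1 \<phi> x)\<^sup>2 + (pderiv_at 2 \<phi> x)\<^sup>2 - 8 * (\<phi> x)\<^sup>2 * (m / E)"
    using E(1) by (simp add: field_simps power2_eq_square)
  also have "m / E = 1 / s\<^sup>2"
    using ms by (simp add: E(2))
  finally show ?thesis
    by (simp add: index_form_def s_def power2_eq_square[of "pderiv_at _ \<phi> x"] power2_eq_square[of "\<phi> x"] mult.assoc)
qed

section \<open>The unit circle, where the formula for the patch breaks down\<close>

lemma not_continuous_arctan_divide:
  fixes N D :: "real \<Rightarrow> real"
  assumes N: "isCont N 0" "N 0 \<noteq> 0" and D: "isCont D 0" "D 0 = 0" "\<forall>\<^sub>F t in at 0. D t \<noteq> 0"
  shows "\<not> isCont (\<lambda>t. arctan (N t / D t)) 0"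
proof
  assume "isCont (\<lambda>t. arctan (N t / D t)) 0"
  \<comment> \<open>Division by zero yields 0, so the value at 0 is \<open>arctan 0\<close>. Taking
    tan, N / D would tend to 0, and multiplying by D so would N, against
    \<open>N 0 \<noteq> 0\<close>.\<close>
  then have "((\<lambda>t. arctan (N t / D t)) \<longlongrightarrow> 0) (at 0)"
    using D(2) by (simp add: isCont_def)
  then have "((\<lambda>t. tan (arctan (N t / D t))) \<longlongrightarrow> tan 0) (at 0)"
    by (intro tendsto_tan) auto
  moreover have "(D \<longlongrightarrow> 0) (at 0)"
    using D(1,2) by (simp add: isCont_def)
  ultimately have "((\<lambda>t. N t / D t * D t) \<longlongrightarrow> 0) (at 0)"
    using tendsto_mult by (fastforce simp: tan_arctan)
  then have "(N \<longlongrightarrow> 0) (at 0)"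
    by (rule Lim_transform_eventually) (use D(3) in \<open>auto elim: eventually_mono\<close>)
  with N show False
    using LIM_unique by (auto simp: isCont_def)
qed

text \<open>On the unit circle the first coordinate of \<open>scherk\<close> jumps across the circle, so neither partial
  derivative exists there and both \<open>pderiv_at\<close> values are the same unspecified vector.  The
  resulting first form is singular, hence its determinant and the whole integrand vanish.\<close>

lemma pderiv_scherk_sphere:
  assumes x: "x \<in> Omega0" "x \<in> sphere 0 1"
  shows "pderiv_at i scherk x = (SOME _. False)"
proof -
  obtain u v where uv: "x = (u, v)" by (cases x)
  have bounds: "\<bar>u\<bar> < 1" "\<bar>v\<bar> < 1" and eq: "u\<^sup>2 + v\<^sup>2 = 1"
    using x by (auto simp: uv mem_Omega0_iff norm_Pair_eq_1_iff)
  have nz: "u \<noteq> 0" "v \<noteq> 0"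
    using bounds eq by (auto simp: power2_eq_1_iff)
  obtain p q where pq: "coord_dir i = (p, q)" "p = 1 \<and> q = 0 \<or> p = 0 \<and> q = 1"
    by (cases "i = 1") (auto simp: coord_dir_def)
  let ?N = "\<lambda>t. 2 * (u + t * p)"
  let ?D = "\<lambda>t. (u + t * p)\<^sup>2 + (v + t * q)\<^sup>2 - 1"
  \<comment> \<open>The coordinate line meets the circle transversally: the zero of
    \<open>?D\<close> at 0 is simple, because neither coordinate of a circle point inside the open
    square is 0.\<close>
  have "?D t = t * (t + 2 * (u * p + v * q))" for t
    using pq(2) eq by (auto simp: power2_eq_square algebra_simps)
  moreover have "u * p + v * q \<noteq> 0"
    using pq(2) nz by auto
  then have "\<forall>\<^sub>F t in at 0. t \<noteq> - (2 * (u * p + v * q))"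
    by (intro eventually_neq_at_within)
  then have "\<forall>\<^sub>F t in at 0. t * (t + 2 * (u * p + v * q)) \<noteq> 0"
    using eventually_neq_at_within[of 0 0]
    by eventually_elim (simp add: add_eq_0_iff2 eq_neg_iff_add_eq_0)
  ultimately have "\<forall>\<^sub>F t in at 0. ?D t \<noteq> 0" by simp
  then have ncont: "\<not> isCont (\<lambda>t. arctan (?N t / ?D t)) 0"
    using eq nz by (intro not_continuous_arctan_divide) (auto intro!: continuous_intros)
  have "\<not> ((\<lambda>t. scherk (x + t *\<^sub>R coord_dir i)) has_vector_derivative d) (at 0)" for d
  proof
    assume "((\<lambda>t. scherk (x + t *\<^sub>R coord_dir i)) has_vector_derivative d) (at 0)"
    then have "isCont (\<lambda>t. scherk (x + t *\<^sub>R coord_dir i) $ 1) 0"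
      by (intro continuous_intros has_vector_derivative_continuous)
    with ncont show False
      by (simp add: scherk_def uv pq(1))
  qed
  then show ?thesis
    by (simp add: pderiv_at_def vector_derivative_def)
qed

lemma second_variation_integrand_sphere:
  assumes "x \<in> Omega0" "x \<in> sphere 0 1"
  shows "second_variation_integrand scherk \<phi> x = 0"
proof -
  have "det (first_form scherk x) = 0"
    using assms by (simp add: first_form_def det_2 pderiv_scherk_sphere)
  then show ?thesis by (simp add: second_variation_integrand_def)
qed

lemma second_variation_scherk:
  assumes "real_polynomial_function \<phi>"
  shows "second_variation scherk Omega0 \<phi> = (LINT x:Omega0|lborel. index_form \<phi> \<phi> x)"
proof -
  \<comment> \<open>First a pointwise replacement, the indicator recording the value 0 on the
    circle. The almost-everywhere comparison after it then involves only functions whose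
    measurability is clear.\<close>
  have "second_variation scherk Omega0 \<phi> = (LINT x:Omega0|lborel. indicator (- sphere 0 1) x * index_form \<phi> \<phi> x)"
    unfolding second_variation_def second_variation_integrand_def[symmetric]
    using second_variation_integrand_sphere second_variation_integrand_scherk_dom
    by (intro set_lebesgue_integral_cong) (auto simp: scherk_dom_def indicator_def)
  also have "\<dots> = (LINT x:Omega0|lborel. index_form \<phi> \<phi> x)"
  proof (rule set_lebesgue_integral_cong_AE)
    have [measurable]: "index_form \<phi> \<phi> \<in> borel_measurable borel"
      by (intro borel_measurable_continuous_onI continuous_on_index_form assms)
    show "index_form \<phi> \<phi> \<in> borel_measurable lborel"
      "(\<lambda>x. indicator (- sphere 0 1) x * index_form \<phi> \<phi> x) \<in> borel_measurable lborel"
      by measurable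
    have "sphere (0 :: real \<times> real) 1 \<in> null_sets lborel"
      using negligible_sphere[of "0 :: real \<times> real" 1]
      by (auto simp: null_sets_completion_iff negligible_iff_null_sets)
    from AE_not_in[OF this]
    show "AE x\<in>Omega0 in lborel. indicator (- sphere 0 1) x * index_form \<phi> \<phi> x = index_form \<phi> \<phi> x"
      by eventually_elim simp
  qed simp
  finally show ?thesis .
qed

section \<open>The three destabilizing functions\<close>

lemma fst_snd_polynomial:
  "real_polynomial_function (fst :: real \<times> real \<Rightarrow> real)" "real_polynomial_function (snd :: real \<times> real \<Rightarrow> real)"
  by (auto intro: real_polynomial_function.intros(1) bounded_linear_fst bounded_linear_snd)

lemma phi_polynomial:
  "real_polynomial_function phi1" "real_polynomial_function phi2" "real_polynomial_function phi3"
proof -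
  have "phi1 = (\<lambda>x. (fst x * snd x)\<^sup>2 + 2)" "phi2 = (\<lambda>x. fst x - 1 / 4 * fst x ^ 5)"
    "phi3 = (\<lambda>x. snd x - 1 / 4 * snd x ^ 5)"
    by (auto simp: phi1_def phi2_def phi3_def)
  note phi = this
  show "real_polynomial_function phi1"
    unfolding phi(1) by (intro real_polynomial_function.intros(2-4) real_polynomial_function_power fst_snd_polynomial)
  show "real_polynomial_function phi2" "real_polynomial_function phi3"
    unfolding phi(2,3) by (intro real_polynomial_function_diff real_polynomial_function.intros(2-4)
        real_polynomial_function_power fst_snd_polynomial)+
qed

lemma pderiv_phi:
  "pderiv_at 1 phi1 (u, v) = 2 * u * v\<^sup>2" "pderiv_at 2 phi1 (u, v) = 2 * u\<^sup>2 * v"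
  "pderiv_at 1 phi2 (u, v) = 1 - 5 / 4 * u ^ 4" "pderiv_at 2 phi2 (u, v) = 0"
  "pderiv_at 1 phi3 (u, v) = 0" "pderiv_at 2 phi3 (u, v) = 1 - 5 / 4 * v ^ 4"
  by (rule pderiv_at_eqI;
      auto simp: phi1_def phi2_def phi3_def coord_dir_def has_real_derivative_iff_has_vector_derivative[symmetric]
        power2_eq_square intro!: derivative_eq_intros)+

lemma phi_apply:
  "phi1 (u, v) = (u * v)\<^sup>2 + 2" "phi2 (u, v) = u - 1 / 4 * u ^ 5" "phi3 (u, v) = v - 1 / 4 * v ^ 5"
  by (simp_all add: phi1_def phi2_def phi3_def)

lemma phi_parity:
  "phi1 (- u, v) = phi1 (u, v)" "phi1 (u, - v) = phi1 (u, v)"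
  "phi2 (- u, v) = - phi2 (u, v)" "phi2 (u, - v) = phi2 (u, v)"
  "phi3 (- u, v) = phi3 (u, v)" "phi3 (u, - v) = - phi3 (u, v)"
  by (simp_all add: phi1_def phi2_def phi3_def)

text \<open>The weight is even in \<open>u\<close> and in \<open>v\<close>, so each mixed density
  inherits the parity of the product: odd in \<open>u\<close>, in \<open>v\<close> and in
  \<open>u\<close> respectively.\<close>

lemma integral_index_form_phi_eq_0:
  "(LINT x:Omega0|lborel. index_form phi1 phi2 x) = 0"
  "(LINT x:Omega0|lborel. index_form phi1 phi3 x) = 0"
  "(LINT x:Omega0|lborel. index_form phi2 phi3 x) = 0"
proof -
  note odd_fst = integral_Omega0_odd_fst[OF continuous_on_index_form]
    and odd_snd = integral_Omega0_odd_snd[OF continuous_on_index_form]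
  show "(LINT x:Omega0|lborel. index_form phi1 phi2 x) = 0"
    by (rule odd_fst[OF phi_polynomial(1,2)]) (simp add: index_form_def pderiv_phi norm_Pair_power2 phi_parity)
  show "(LINT x:Omega0|lborel. index_form phi1 phi3 x) = 0"
    by (rule odd_snd[OF phi_polynomial(1,3)]) (simp add: index_form_def pderiv_phi norm_Pair_power2 phi_parity)
  show "(LINT x:Omega0|lborel. index_form phi2 phi3 x) = 0"
    by (rule odd_fst[OF phi_polynomial(2,3)]) (simp add: index_form_def pderiv_phi norm_Pair_power2 phi_parity)
qed

section \<open>Negativity of the form on each perturbation\<close>

lemma integral_FTC:
  fixes g G :: "real \<Rightarrow> real"
  assumes "\<And>x. (G has_real_derivative g x) (at x)" "a \<le> b"
  shows "integral {a..b} g = G b - G a"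
  using assms
  by (intro integral_unique fundamental_theorem_of_calculus)
    (auto simp: has_real_derivative_iff_has_vector_derivative intro: has_vector_derivative_at_within)

lemma integral_even_poly_6:
  fixes a b c d :: real
  shows "integral {-1..1} (\<lambda>v. a + b * v\<^sup>2 + c * v ^ 4 + d * v ^ 6) = 2 * a + 2 * b / 3 + 2 * c / 5 + 2 * d / 7"
proof -
  have "((\<lambda>v. a * v + b * v ^ 3 / 3 + c * v ^ 5 / 5 + d * v ^ 7 / 7) has_real_derivative
      a + b * v\<^sup>2 + c * v ^ 4 + d * v ^ 6) (at v)" for v
    by (auto intro!: derivative_eq_intros simp: power2_eq_square)
  then show ?thesis by (subst integral_FTC) auto
qed

lemma integral_index_form_phi1: "(LINT x:Omega0|lborel. index_form phi1 phi1 x) < 0"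
proof -
  \<comment> \<open>The constant is - 8 * 4 / 9: on the square \<open>phi1\<close> is at least 2 and
    (1 + |z|^2)^2 at most 9. The zero term pads \<open>g\<close> to the shape of
    \<open>integral_even_poly_6\<close>.\<close>
  define g where "g = (\<lambda>(u :: real, v :: real). - 32 / 9 + 4 * u ^ 4 * v\<^sup>2 + 4 * u\<^sup>2 * v ^ 4 + 0 * v ^ 6 :: real)"
  have g: "continuous_on UNIV g"
    unfolding g_def case_prod_unfold by (intro continuous_intros)
  have "(LINT x:Omega0|lborel. index_form phi1 phi1 x) \<le> (LINT x:Omega0|lborel. g x)"
  proof (intro set_integral_mono set_integrable_Omega0 continuous_on_index_form phi_polynomial g)
    fix x assume x: "x \<in> Omega0"
    obtain u v where uv: "x = (u, v)" by (cases x)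
    have "u\<^sup>2 < 1" "v\<^sup>2 < 1"
      using x by (auto simp: uv mem_Omega0_iff abs_square_less_1)
    then have "(1 + (u\<^sup>2 + v\<^sup>2))\<^sup>2 \<le> 3\<^sup>2"
      by (intro power_mono) auto
    moreover have "2\<^sup>2 \<le> ((u * v)\<^sup>2 + 2)\<^sup>2"
      by (intro power_mono) auto
    moreover have "0 < (1 + (u\<^sup>2 + v\<^sup>2))\<^sup>2"
      by (intro zero_less_power add_pos_nonneg) auto
    ultimately have "4 / 9 \<le> ((u * v)\<^sup>2 + 2)\<^sup>2 / (1 + (u\<^sup>2 + v\<^sup>2))\<^sup>2"
      by (intro frac_le) auto
    moreover have "index_form phi1 phi1 x
        = 4 * u ^ 4 * v\<^sup>2 + 4 * u\<^sup>2 * v ^ 4 - 8 * (((u * v)\<^sup>2 + 2)\<^sup>2 / (1 + (u\<^sup>2 + v\<^sup>2))\<^sup>2)"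
      unfolding uv index_form_def pderiv_phi norm_Pair_power2 phi_apply divide_inverse by algebra
    ultimately show "index_form phi1 phi1 x \<le> g x"
      by (simp add: uv g_def)
  qed
  also have "(LINT x:Omega0|lborel. g x) = integral {-1..1} (\<lambda>u. - 64 / 9 + 8 / 5 * u\<^sup>2 + 8 / 3 * u ^ 4 + 0 * u ^ 6)"
  proof -
    have "integral {-1..1} (\<lambda>v. g (u, v)) = - 64 / 9 + 8 / 5 * u\<^sup>2 + 8 / 3 * u ^ 4 + 0 * u ^ 6" for u
      unfolding g_def prod.case integral_even_poly_6 by simp
    then show ?thesis by (simp only: integral_Omega0[OF g])
  qed
  also have "\<dots> < 0"
    unfolding integral_even_poly_6 by simp
  finally show ?thesis .
qed

text \<open>The cubic touches the convex function \<open>1 / (1 + s)\<^sup>2\<close> from below at \<open>s = 1 / 2\<close> and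
  \<open>s = 7 / 5\<close>; tangent lines are too weak for the test function \<open>phi2\<close>.\<close>

lemma cubic_minorant:
  fixes s :: real
  assumes "s \<ge> 0"
  shows "(6845 - 9273 * s + 5640 * s\<^sup>2 - 1300 * s ^ 3) / 7776 \<le> 1 / (1 + s)\<^sup>2"
proof -
  \<comment> \<open>The double zeros are the two points of contact; the remaining linear factor is
    positive for \<open>s \<ge> 0\<close>.\<close>
  have "7776 - (6845 - 9273 * s + 5640 * s\<^sup>2 - 1300 * s ^ 3) * (1 + s)\<^sup>2 = (2 * s - 1)\<^sup>2 * (5 * s - 7)\<^sup>2 * (13 * s + 19)"
    by algebra
  also have "\<dots> \<ge> 0"
    using assms by simp
  finally show ?thesis
    using assms by (simp add: divide_simps add_pos_nonneg)
qed

lemma integral_index_form_phi2: "(LINT x:Omega0|lborel. index_form phi2 phi2 x) < 0"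
proof -
  define f where "f u = u - 1 / 4 * u ^ 5" for u :: real
  \<comment> \<open>The density with the cubic minorant at s = u^2 + v^2 in place of the weight,
    sorted by powers of \<open>v\<close>; \<open>h\<close> below is its integral over
    \<open>v\<close>, expanded in \<open>u\<close>.\<close>
  define g where "g = (\<lambda>(u :: real, v :: real).
      ((1 - 5 / 4 * u ^ 4)\<^sup>2 - 8 * (f u)\<^sup>2 * (6845 - 9273 * u\<^sup>2 + 5640 * u ^ 4 - 1300 * u ^ 6) / 7776)
      + (- 8 * (f u)\<^sup>2 * (- 9273 + 11280 * u\<^sup>2 - 3900 * u ^ 4) / 7776) * v\<^sup>2
      + (- 8 * (f u)\<^sup>2 * (5640 - 3900 * u\<^sup>2) / 7776) * v ^ 4
      + (8 * (f u)\<^sup>2 * 1300 / 7776) * v ^ 6)"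
  define h where "h u = 2 + (-5479/567) * u^2 + 3863/486 * u^4
      + (-13943/3402) * u^6 + (-437/648) * u^8 + 105083/27216 * u^10 + (-1369/2592) * u^12
      + (-1085/1944) * u^14 + 325/1944 * u^16" for u :: real
  have g: "continuous_on UNIV g"
    unfolding g_def f_def case_prod_unfold by (intro continuous_intros) auto
  have "(LINT x:Omega0|lborel. index_form phi2 phi2 x) \<le> (LINT x:Omega0|lborel. g x)"
  proof (intro set_integral_mono set_integrable_Omega0 continuous_on_index_form phi_polynomial g)
    fix x :: "real \<times> real"
    obtain u v where uv: "x = (u, v)" by (cases x)
    define s where "s = u\<^sup>2 + v\<^sup>2"
    have "index_form phi2 phi2 x = (1 - 5 / 4 * u ^ 4)\<^sup>2 - 8 * (f u)\<^sup>2 * (1 / (1 + s)\<^sup>2)"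
      unfolding uv index_form_def pderiv_phi norm_Pair_power2 phi_apply f_def s_def divide_inverse by algebra
    also have "\<dots> \<le> (1 - 5 / 4 * u ^ 4)\<^sup>2
        - 8 * (f u)\<^sup>2 * ((6845 - 9273 * s + 5640 * s\<^sup>2 - 1300 * s ^ 3) / 7776)"
      by (intro diff_left_mono mult_left_mono cubic_minorant) (auto simp: s_def)
    also have "\<dots> = g x"
      unfolding uv g_def s_def prod.case by (simp add: field_simps) algebra
    finally show "index_form phi2 phi2 x \<le> g x" .
  qed
  also have "(LINT x:Omega0|lborel. g x) = integral {-1..1} h"
  proof -
    have "integral {-1..1} (\<lambda>v. g (u, v)) = h u" for u
      unfolding g_def prod.case integral_even_poly_6 f_def h_def by (simp add: field_simps) algebra
    then show ?thesis by (simp only: integral_Omega0[OF g])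
  qed
  also have "\<dots> < 0"
  proof -
    \<comment> \<open>The termwise antiderivative of \<open>h\<close>. The resulting integral is
      about - 0.0175, so the minorant has little room to spare.\<close>
    define H where "H u = 2 * u + (-5479/1701) * u ^ 3 + (3863/2430) * u ^ 5
      + (-13943/23814) * u ^ 7 + (-437/5832) * u ^ 9 + (9553/27216) * u ^ 11
      + (-1369/33696) * u ^ 13 + (-217/5832) * u ^ 15 + (325/33048) * u ^ 17" for u :: real
    have "integral {-1..1} h = H 1 - H (- 1)"
      unfolding H_def h_def by (rule integral_FTC) (auto intro!: derivative_eq_intros)
    then show ?thesis by (simp add: H_def)
  qed
  finally show ?thesis by simp
qed

text \<open>Exchanging the coordinates carries \<open>phi3\<close> to \<open>phi2\<close> and
  preserves the weight; the two orders of iterated integration then agree.\<close>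

lemma integral_index_form_phi3: "(LINT x:Omega0|lborel. index_form phi3 phi3 x) < 0"
proof -
  have "index_form phi3 phi3 (u, v) = index_form phi2 phi2 (v, u)" for u v
    by (simp add: index_form_def pderiv_phi norm_Pair_power2 phi_apply add.commute)
  then have "(LINT x:Omega0|lborel. index_form phi3 phi3 x) = (LINT x:Omega0|lborel. index_form phi2 phi2 x)"
    by (simp add: integral_Omega0[of "index_form phi3 phi3"] integral_Omega0_swap[of "index_form phi2 phi2"]
        continuous_on_index_form phi_polynomial)
  with integral_index_form_phi2 show ?thesis by simp
qed

section \<open>The span of the perturbations and the index\<close>

definition phi_comb :: "real \<Rightarrow> real \<Rightarrow> real \<Rightarrow> real \<times> real \<Rightarrow> real" where
  "phi_comb a b c = (\<lambda>x. a * phi1 x + b * phi2 x + c * phi3 x)"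

lemma phi_comb_polynomial: "real_polynomial_function (phi_comb a b c)"
  unfolding phi_comb_def by (intro real_polynomial_function.intros(2-4) phi_polynomial)

lemma pderiv_phi_comb:
  "pderiv_at i (phi_comb a b c) x = a * pderiv_at i phi1 x + b * pderiv_at i phi2 x + c * pderiv_at i phi3 x"
proof -
  have "((\<lambda>t. phi (x + t *\<^sub>R coord_dir i)) has_real_derivative pderiv_at i phi x) (at 0)"
    if "real_polynomial_function phi" for phi
    using has_vector_derivative_along_coord[of phi x 0 i] real_polynomial_function_differentiable[OF that]
    by (simp add: has_real_derivative_iff_has_vector_derivative)
  note this[OF phi_polynomial(1)] this[OF phi_polynomial(2)] this[OF phi_polynomial(3)]
  then have "((\<lambda>t. phi_comb a b c (x + t *\<^sub>R coord_dir i)) has_real_derivative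
      a * pderiv_at i phi1 x + b * pderiv_at i phi2 x + c * pderiv_at i phi3 x) (at 0)"
    unfolding phi_comb_def by (auto intro!: derivative_eq_intros)
  then show ?thesis
    by (intro pderiv_at_eqI) (simp add: has_real_derivative_iff_has_vector_derivative)
qed

text \<open>Expanding the form bilinearly leaves only the diagonal terms, since the mixed ones
  integrate to 0 by parity.\<close>

lemma second_variation_phi_comb:
  "second_variation scherk Omega0 (phi_comb a b c) =
     a\<^sup>2 * (LINT x:Omega0|lborel. index_form phi1 phi1 x)
   + b\<^sup>2 * (LINT x:Omega0|lborel. index_form phi2 phi2 x)
   + c\<^sup>2 * (LINT x:Omega0|lborel. index_form phi3 phi3 x)"
proof -
  have eq: "index_form (phi_comb a b c) (phi_comb a b c) =
     (\<lambda>x. a\<^sup>2 * index_form phi1 phi1 x + b\<^sup>2 * index_form phi2 phi2 x + c\<^sup>2 * index_form phi3 phi3 x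
        + 2 * a * b * index_form phi1 phi2 x + 2 * a * c * index_form phi1 phi3 x
        + 2 * b * c * index_form phi2 phi3 x)"
    unfolding fun_eq_iff index_form_def pderiv_phi_comb divide_inverse
    by (simp add: phi_comb_def) algebra
  have int: "set_integrable lborel Omega0 (\<lambda>x. k * index_form \<phi> \<psi> x)"
    if "real_polynomial_function \<phi>" "real_polynomial_function \<psi>" for k \<phi> \<psi>
    using that by (intro set_integrable_Omega0 continuous_intros)
  note ints = int[OF phi_polynomial(1,1)] int[OF phi_polynomial(2,2)] int[OF phi_polynomial(3,3)]
    int[OF phi_polynomial(1,2)] int[OF phi_polynomial(1,3)] int[OF phi_polynomial(2,3)]
  show ?thesis
    unfolding second_variation_scherk[OF phi_comb_polynomial] eq
    by (simp add: set_integral_add ints integral_index_form_phi_eq_0)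
qed

lemma second_variation_phi_comb_neg:
  assumes "(a, b, c) \<noteq> (0, 0, 0)"
  shows "second_variation scherk Omega0 (phi_comb a b c) < 0"
proof -
  have sq: "k\<^sup>2 * I \<le> 0" "k \<noteq> 0 \<Longrightarrow> k\<^sup>2 * I < 0" if "I < 0" for k I :: real
    using that by (auto simp: mult_less_0_iff mult_le_0_iff)
  note sq[OF integral_index_form_phi1, of a] sq[OF integral_index_form_phi2, of b] sq[OF integral_index_form_phi3, of c]
  then show ?thesis
    unfolding second_variation_phi_comb using assms by fastforce
qed

lemma phi_eq_phi_comb: "phi1 = phi_comb 1 0 0" "phi2 = phi_comb 0 1 0" "phi3 = phi_comb 0 0 1"
  by (simp_all add: phi_comb_def)

lemma span_phi:
  "f \<in> fun_space.span {phi1, phi2, phi3} \<longleftrightarrow> (\<exists>a b c. f = phi_comb a b c)"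
  unfolding fun_space.span_breakdown_eq fun_space.span_empty
  by (auto simp: phi_comb_def fun_eq_iff algebra_simps)

text \<open>Evaluation at single points separates the functions: at the origin only
  \<open>phi1\<close> is nonzero, at (1, 0) \<open>phi3\<close> vanishes but \<open>phi2\<close>
  does not, and \<open>phi3\<close> is nonzero at (0, 1).\<close>

lemma phi_independent: "fun_space.independent {phi1, phi2, phi3}" and card_phi: "card {phi1, phi2, phi3} = 3"
proof -
  have neq: "phi1 \<notin> fun_space.span {phi2, phi3}" "phi2 \<notin> fun_space.span {phi3}" "phi3 \<notin> fun_space.span {}"
  proof -
    have "phi1 (0, 0) = 0" if span: "phi1 \<in> fun_space.span {phi2, phi3}"
    proof -
      obtain k l where "phi1 (u, v) - k * phi2 (u, v) - l * phi3 (u, v) = 0" for u v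
        using span unfolding fun_space.span_breakdown_eq fun_space.span_empty
        by (auto simp: fun_eq_iff)
      from this[of 0 0] show ?thesis by (simp add: phi_apply)
    qed
    then show "phi1 \<notin> fun_space.span {phi2, phi3}" by (auto simp: phi_apply)
    have "phi2 (1, 0) = 0" if span: "phi2 \<in> fun_space.span {phi3}"
    proof -
      obtain k where "phi2 (u, v) = k * phi3 (u, v)" for u v
        using span unfolding fun_space.span_breakdown_eq fun_space.span_empty
        by (auto simp: fun_eq_iff)
      from this[of 1 0] show ?thesis by (simp add: phi_apply)
    qed
    then show "phi2 \<notin> fun_space.span {phi3}" by (auto simp: phi_apply)
    have "phi3 (0, 1) \<noteq> 0" by (simp add: phi_apply)
    then show "phi3 \<notin> fun_space.span {}" by (auto simp: fun_space.span_empty)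
  qed
  then show "fun_space.independent {phi1, phi2, phi3}"
    by (simp add: fun_space.independent_insert fun_space.independent_empty)
  have "phi1 (0, 0) \<noteq> phi2 (0, 0)" "phi1 (0, 0) \<noteq> phi3 (0, 0)" "phi2 (1, 0) \<noteq> phi3 (1, 0)"
    by (simp_all add: phi_apply)
  then have "phi1 \<noteq> phi2" "phi1 \<noteq> phi3" "phi2 \<noteq> phi3" by metis+
  then show "card {phi1, phi2, phi3} = 3" by simp
qed

theorem theorem2p3:
  shows "L2_orthogonal Omega0 phi1 phi2 \<and> L2_orthogonal Omega0 phi1 phi3 \<and> L2_orthogonal Omega0 phi2 phi3
    \<and> (\<forall>\<phi>\<in>{phi1, phi2, phi3}. \<phi> \<in> admissible Omega0 \<and> destabilizes scherk Omega0 \<phi>)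
    \<and> ind_b scherk Omega0 \<ge> 3"
proof (intro conjI)
  have orth: "L2_orthogonal Omega0 \<phi> \<psi>"
    if "real_polynomial_function \<phi>" "real_polynomial_function \<psi>"
      "(\<forall>u v. \<phi> (- u, v) * \<psi> (- u, v) = - (\<phi> (u, v) * \<psi> (u, v)))
       \<or> (\<forall>u v. \<phi> (u, - v) * \<psi> (u, - v) = - (\<phi> (u, v) * \<psi> (u, v)))" for \<phi> \<psi>
  proof -
    have "continuous_on UNIV (\<lambda>x. \<phi> x * \<psi> x)"
      using that by (intro continuous_intros real_polynomial_function_continuous_on)
    then show ?thesis
      using that integral_Omega0_odd_fst[of "\<lambda>x. \<phi> x * \<psi> x"] integral_Omega0_odd_snd[of "\<lambda>x. \<phi> x * \<psi> x"]
      by (auto simp: L2_orthogonal_def L2_inner_def real_polynomial_function_L2_Omega0)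
  qed
  show "L2_orthogonal Omega0 phi1 phi2" "L2_orthogonal Omega0 phi1 phi3" "L2_orthogonal Omega0 phi2 phi3"
    by (intro orth phi_polynomial; simp add: phi_parity)+
  show "\<forall>\<phi>\<in>{phi1, phi2, phi3}. \<phi> \<in> admissible Omega0 \<and> destabilizes scherk Omega0 \<phi>"
    \<comment> \<open>Each perturbation is a combination with one coefficient 1, so the negativity
      proved for the span covers it.\<close>
    unfolding phi_eq_phi_comb
    by (auto simp: destabilizes_def second_variation_phi_comb_neg phi_comb_polynomial
        real_polynomial_function_admissible)
  \<comment> \<open>The three-dimensional span is the witness in the supremum defining the
    index.\<close>
  let ?V = "fun_space.span {phi1, phi2, phi3}"
  have "?V \<subseteq> admissible Omega0"
    by (auto simp: span_phi intro!: real_polynomial_function_admissible phi_comb_polynomial)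
  moreover have "negative_definite_on (second_variation scherk Omega0) ?V"
    unfolding negative_definite_on_def
  proof (intro ballI impI)
    fix \<phi> assume "\<phi> \<in> ?V" "\<phi> \<noteq> 0"
    then obtain a b c where "\<phi> = phi_comb a b c" by (auto simp: span_phi)
    moreover from this \<open>\<phi> \<noteq> 0\<close> have "(a, b, c) \<noteq> (0, 0, 0)"
      by (auto simp: phi_comb_def fun_eq_iff)
    ultimately show "second_variation scherk Omega0 \<phi> < 0"
      using second_variation_phi_comb_neg by simp
  qed
  moreover have "fun_space.dim ?V = 3"
    using fun_space.dim_span_eq_card_independent[OF phi_independent] card_phi by simp
  ultimately have "enat 3 \<le> ind_b scherk Omega0"
    unfolding ind_b_def by (intro SUP_upper2[of ?V]) auto
  then show "3 \<le> ind_b scherk Omega0"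
    by (simp add: numeral_eq_enat)
qed

end
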